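(* Let $\Sigma$ be a finite set, $L_I\subset\Sigma^{\ast}$ a language, $L_\circ\subset\Sigma^{\ast}_\circ$ a circular language, and $\alpha$ the evaluation determined by $L=(L_I,L_{\circ})$. Then $L$ is $\mathcal{C}$-regular (all hom spaces $\mathrm{Hom}_{\mathcal{C}_\alpha}(\varepsilon,\varepsilon')$ are finite) if and only if both languages $L_I$ and $L_{\circ}$ are regular.
   Context: $\mathbb{B}=\{0,1\mid 1+1=1\}$ is the Boolean semiring; a $\mathbb{B}$-semimodule is a commutative monoid $(M,+,0)$ with $a+a=a$. It is finitely generated iff it is a finite set. $\Sigma^{\ast}$ is the set of words in $\Sigma$; $\Sigma^{\ast}_{\circ}$ is the quotient of $\Sigma^{\ast}$ by $\omega_1\omega_2\sim\omega_2\omega_1$ (circular words). $\alpha_I:\Sigma^{\ast}\to\mathbb{B}$ and $\alpha_\circ:\Sigma^{\ast}_\circ\to\mathbb{B}$ are the characteristic functions of $L_I$ and $L_\circ$. The circular language $L_\circ$ is called regular if its preimage in $\Sigma^{\ast}$ is a regular language. The category $\mathcal{C}_\Sigma$: objects are finite sequences $\varepsilon$ of signs $\pm$ (the empty sequence is $\emptyset$). A morphism $\varepsilon\to\varepsilon'$ is an oriented compact one-dimensional cobordism from $\varepsilon$ (bottom) to $\varepsilon'$ (top), with finitely many interior points labelled by elements of $\Sigma$; in addition to outer endpoints (matching the signs of $\varepsilon,\varepsilon'$) components may have inner ("floating") endpoints strictly inside the cobordism. Cobordisms are taken up to diffeomorphism rel outer boundary; composition is concatenation and tensor product is placing side by side.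 An endomorphism of $\emptyset$ is a disjoint union of intervals $I(\omega)$, $\omega\in\Sigma^{\ast}$, and circles $S(\omega)$, $\omega\in\Sigma^{\ast}_\circ$, with $\omega$ read along the orientation. Evaluation: $\alpha(I(\omega))=\alpha_I(\omega)$, $\alpha(S(\omega))=\alpha_\circ(\omega)$, multiplicative on disjoint unions, with $\alpha(\text{empty})=1$. The category $\mathcal{C}_\alpha$ has the same objects; $\mathrm{Hom}_{\mathcal{C}_\alpha}(\varepsilon,\varepsilon')$ is the quotient of the free $\mathbb{B}$-semimodule on $\mathrm{Hom}_{\mathcal{C}_\Sigma}(\varepsilon,\varepsilon')$ by the relation $\sum_i f_i\sim\sum_j g_j$ iff $\sum_i\alpha(\mathrm{cl}(f_i,h))=\sum_j\alpha(\mathrm{cl}(g_j,h))$ for every cobordism $h:\varepsilon'\to\varepsilon$, where $\mathrm{cl}(f,h)$ is the closed cobordism obtained by gluing $f$ and $h$ along all outer endpoints. The pair $L$ is called $\mathcal{C}$-regular if all hom spaces of $\mathcal{C}_\alpha$ are finite (equivalently, finitely generated $\mathbb{B}$-semimodules). *)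

theory Defs
  imports "HOL-Library.Multiset"
begin

section \<open>Languages and circular languages\<close>

text \<open>
  Acceptance by a deterministic finite automaton. Any finite state set can be renamed to a set
  of natural numbers, so fixing the type of states is no restriction.
\<close>

definition regular_lang :: "'a set \<Rightarrow> 'a list set \<Rightarrow> bool" where
  "regular_lang \<Sigma> L \<longleftrightarrow>
    (\<exists>(Q :: nat set) q0 F (\<delta> :: nat \<Rightarrow> 'a \<Rightarrow> nat).
       finite Q \<and> q0 \<in> Q \<and> F \<subseteq> Q \<and> (\<forall>q\<in>Q. \<forall>a\<in>\<Sigma>. \<delta> q a \<in> Q) \<and>
       L = {w \<in> lists \<Sigma>. foldl \<delta> q0 w \<in> F})"

definition conjugate :: "'a list \<Rightarrow> 'a list \<Rightarrow> bool" where
  "conjugate u v \<longleftrightarrow> (\<exists>x y. u = x @ y \<and> v = y @ x)"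

lemma conjugate_iff_rotate: "conjugate u v \<longleftrightarrow> (\<exists>n. v = rotate n u)"
proof
  assume "conjugate u v"
  then obtain x y where "u = x @ y" "v = y @ x"
    unfolding conjugate_def by blast
  then show "\<exists>n. v = rotate n u"
    by (metis rotate_append)
next
  assume "\<exists>n. v = rotate n u"
  then obtain n where "v = rotate n u" by blast
  then have "v = drop (n mod length u) u @ take (n mod length u) u"
    by (simp add: rotate_drop_take)
  then show "conjugate u v"
    unfolding conjugate_def by (metis append_take_drop_id)
qed

lemma equivp_conjugate: "equivp (conjugate :: 'a list \<Rightarrow> 'a list \<Rightarrow> bool)"
proof (rule equivpI)
  show "reflp (conjugate :: 'a list \<Rightarrow> 'a list \<Rightarrow> bool)"
    unfolding reflp_def conjugate_def by (metis append_Nil append_Nil2)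
  show "symp (conjugate :: 'a list \<Rightarrow> 'a list \<Rightarrow> bool)"
    unfolding symp_def conjugate_def by blast
  show "transp (conjugate :: 'a list \<Rightarrow> 'a list \<Rightarrow> bool)"
    unfolding transp_def conjugate_iff_rotate by (metis rotate_rotate)
qed

quotient_type 'a cword = "'a list" / conjugate
  by (rule equivp_conjugate)

lift_definition cword :: "'a list \<Rightarrow> 'a cword" is "\<lambda>w. w" .

definition cwords :: "'a set \<Rightarrow> 'a cword set" where
  "cwords \<Sigma> = cword ` lists \<Sigma>"

definition regular_clang :: "'a set \<Rightarrow> 'a cword set \<Rightarrow> bool" where
  "regular_clang \<Sigma> L \<longleftrightarrow> regular_lang \<Sigma> {w \<in> lists \<Sigma>. cword w \<in> L}"


section \<open>Cobordisms\<close>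

datatype sign = Plus | Minus

text \<open>
  \<open>Bot i\<close> and \<open>Top j\<close> are the outer endpoints, indexed by the positions in the bottom and
  the top sign sequence; \<open>Inner\<close> stands for any floating endpoint.
\<close>

datatype endpoint = Inner | Bot nat | Top nat

text \<open>
  A connected component is an oriented interval \<open>Arc p w q\<close>, running from \<open>p\<close> to \<open>q\<close> with
  labels \<open>w\<close> in the order of the orientation, or an oriented circle. A compact oriented
  one-manifold with labelled points is, up to diffeomorphism rel outer boundary, the same
  thing as the multiset of its components.
\<close>

datatype 'a component =
    Arc (src: endpoint) (labels: "'a list") (tgt: endpoint)
  | Circle "'a cword"

type_synonym 'a cob = "'a component multiset"

fun leaves :: "'a component \<Rightarrow> endpoint \<Rightarrow> bool" where
  "leaves (Arc p w q) r \<longleftrightarrow> p = r"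
| "leaves (Circle c) r \<longleftrightarrow> False"

fun enters :: "'a component \<Rightarrow> endpoint \<Rightarrow> bool" where
  "enters (Arc p w q) r \<longleftrightarrow> q = r"
| "enters (Circle c) r \<longleftrightarrow> False"

fun labelled_in :: "'a set \<Rightarrow> 'a component \<Rightarrow> bool" where
  "labelled_in \<Sigma> (Arc p w q) \<longleftrightarrow> w \<in> lists \<Sigma>"
| "labelled_in \<Sigma> (Circle c) \<longleftrightarrow> c \<in> cwords \<Sigma>"

text \<open>
  The sign \<open>Plus\<close> means that the strand is oriented upwards: it leaves a bottom endpoint, or
  enters a top endpoint.
\<close>

definition sources :: "sign list \<Rightarrow> sign list \<Rightarrow> endpoint set" where
  "sources \<epsilon> \<epsilon>' = {Bot i | i. i < length \<epsilon> \<and> \<epsilon> ! i = Plus} \<union>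
                  {Top j | j. j < length \<epsilon>' \<and> \<epsilon>' ! j = Minus}"

definition sinks :: "sign list \<Rightarrow> sign list \<Rightarrow> endpoint set" where
  "sinks \<epsilon> \<epsilon>' = {Bot i | i. i < length \<epsilon> \<and> \<epsilon> ! i = Minus} \<union>
                {Top j | j. j < length \<epsilon>' \<and> \<epsilon>' ! j = Plus}"

definition Hom_cob :: "'a set \<Rightarrow> sign list \<Rightarrow> sign list \<Rightarrow> 'a cob set" where
  "Hom_cob \<Sigma> \<epsilon> \<epsilon>' =
     {M. (\<forall>c \<in># M. labelled_in \<Sigma> c) \<and>
         (\<forall>p. p \<noteq> Inner \<longrightarrow>
            size {#c \<in># M. leaves c p#} = (if p \<in> sources \<epsilon> \<epsilon>' then 1 else 0) \<and>
            size {#c \<in># M. enters c p#} = (if p \<in> sinks \<epsilon> \<epsilon>' then 1 else 0))}"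


section \<open>Gluing and evaluation\<close>

text \<open>
  \<open>join p M\<close> connects the unique component of \<open>M\<close> entering \<open>p\<close> to the unique component
  leaving \<open>p\<close>. If these are the same component, it closes up to a circle.
\<close>

definition join :: "endpoint \<Rightarrow> 'a cob \<Rightarrow> 'a cob" where
  "join p M =
     (let c = (THE c. c \<in># M \<and> enters c p); d = (THE d. d \<in># M \<and> leaves d p)
      in if c = d then add_mset (Circle (cword (labels c))) (M - {#c#})
         else add_mset (Arc (src c) (labels c @ labels d) (tgt d)) (M - {#c, d#}))"

fun swap_endpoint :: "endpoint \<Rightarrow> endpoint" where
  "swap_endpoint Inner = Inner"
| "swap_endpoint (Bot i) = Top i"
| "swap_endpoint (Top i) = Bot i"

fun swap_component :: "'a component \<Rightarrow> 'a component" where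
  "swap_component (Arc p w q) = Arc (swap_endpoint p) w (swap_endpoint q)"
| "swap_component (Circle c) = Circle c"

text \<open>
  For \<open>f : \<epsilon> \<rightarrow> \<epsilon>'\<close> and \<open>h : \<epsilon>' \<rightarrow> \<epsilon>\<close>. The endpoints of \<open>h\<close> are renamed (orientations are kept)
  so that endpoints of \<open>f\<close> and \<open>h\<close> that are to be identified carry the same name; every such
  name is then entered once and left once in the union.
\<close>

definition cl :: "sign list \<Rightarrow> sign list \<Rightarrow> 'a cob \<Rightarrow> 'a cob \<Rightarrow> 'a cob" where
  "cl \<epsilon> \<epsilon>' f h =
     fold join (map Bot [0..<length \<epsilon>] @ map Top [0..<length \<epsilon>'])
       (f + image_mset swap_component h)"

text \<open>
  The Boolean semiring is the type \<open>bool\<close> with disjunction as addition and conjunction as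
  multiplication. The evaluation is only meaningful on closed cobordisms.
\<close>

fun eval_component :: "'a list set \<Rightarrow> 'a cword set \<Rightarrow> 'a component \<Rightarrow> bool" where
  "eval_component LI LC (Arc p w q) \<longleftrightarrow> w \<in> LI"
| "eval_component LI LC (Circle c) \<longleftrightarrow> c \<in> LC"

definition evaluation :: "'a list set \<Rightarrow> 'a cword set \<Rightarrow> 'a cob \<Rightarrow> bool" where
  "evaluation LI LC M \<longleftrightarrow> (\<forall>c \<in># M. eval_component LI LC c)"


section \<open>The state spaces\<close>

text \<open>
  Since addition is idempotent, the free semimodule over the Boolean semiring on a set \<open>X\<close> is
  \<open>Fpow X\<close>, the finite subsets of \<open>X\<close> under union; a sum of Booleans is an existential
  quantifier.
\<close>

definition alpha_equiv ::
  "'a set \<Rightarrow> 'a list set \<Rightarrow> 'a cword set \<Rightarrow> sign list \<Rightarrow> sign list \<Rightarrow> ('a cob set \<times> 'a cob set) set"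
where
  "alpha_equiv \<Sigma> LI LC \<epsilon> \<epsilon>' =
     {(F, G). F \<in> Fpow (Hom_cob \<Sigma> \<epsilon> \<epsilon>') \<and> G \<in> Fpow (Hom_cob \<Sigma> \<epsilon> \<epsilon>') \<and>
        (\<forall>h \<in> Hom_cob \<Sigma> \<epsilon>' \<epsilon>.
           (\<exists>f\<in>F. evaluation LI LC (cl \<epsilon> \<epsilon>' f h)) \<longleftrightarrow>
           (\<exists>g\<in>G. evaluation LI LC (cl \<epsilon> \<epsilon>' g h)))}"

definition Hom_alpha ::
  "'a set \<Rightarrow> 'a list set \<Rightarrow> 'a cword set \<Rightarrow> sign list \<Rightarrow> sign list \<Rightarrow> 'a cob set set set"
where
  "Hom_alpha \<Sigma> LI LC \<epsilon> \<epsilon>' = Fpow (Hom_cob \<Sigma> \<epsilon> \<epsilon>') // alpha_equiv \<Sigma> LI LC \<epsilon> \<epsilon>'"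

definition C_regular :: "'a set \<Rightarrow> 'a list set \<Rightarrow> 'a cword set \<Rightarrow> bool" where
  "C_regular \<Sigma> LI LC \<longleftrightarrow> (\<forall>\<epsilon> \<epsilon>'. finite (Hom_alpha \<Sigma> LI LC \<epsilon> \<epsilon>'))"

end

theory Submission imports Defs "HOL-Library.FuncSet" begin

text \<open>
  A hom space is finite iff the morphisms \<open>f\<close> have finitely many behaviours, where the behaviour
  of \<open>f\<close> is the set of all \<open>h\<close> for which the closure of \<open>f\<close> by \<open>h\<close> evaluates to true. Single
  arcs \<open>[] \<rightarrow> [Plus]\<close> and \<open>[Plus] \<rightarrow> [Plus]\<close> labelled by \<open>u\<close> detect, by gluing on an arc labelled
  by \<open>y\<close>, whether \<open>u @ y\<close> lies in the interval language, or the circular word of \<open>u @ y\<close> in the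
  circular language, so finite hom spaces give finitely many left quotients. Conversely, for
  regular languages the behaviour of \<open>f\<close> depends only on its matching of outer endpoints, the
  syntactic classes of the labels on the arcs touching the outer boundary, and the truth value
  of the remaining, closed part; this is a finite amount of information.
\<close>

section \<open>Syntactic contexts and regularity\<close>

lemma finite_image_factor:
  assumes "finite (f ` A)" and "\<And>x y. x \<in> A \<Longrightarrow> y \<in> A \<Longrightarrow> f x = f y \<Longrightarrow> g x = g y"
  shows "finite (g ` A)"
proof (rule finite_subset)
  show "g ` A \<subseteq> (\<lambda>z. g (inv_into A f z)) ` f ` A"
  proof
    fix z assume "z \<in> g ` A"
    then obtain x where x: "x \<in> A" "z = g x" by blast
    then have "g x = g (inv_into A f (f x))"
      by (intro assms(2)) (auto intro: inv_into_into simp: f_inv_into_f)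
    with x show "z \<in> (\<lambda>z. g (inv_into A f z)) ` f ` A" by blast
  qed
qed (use assms(1) in simp)

text \<open>Equality of these sets is the syntactic congruence of \<open>L\<close>, so
  \<open>contexts L u\<close> serves as a name for the syntactic class of \<open>u\<close>.\<close>

definition contexts :: "'a list set \<Rightarrow> 'a list \<Rightarrow> ('a list \<times> 'a list) set" where
  "contexts L u = {(x, y). x @ u @ y \<in> L}"

text \<open>The factors are replaced one at a time: \<open>v\<close> is first absorbed into the
  right context of \<open>u\<close>, then \<open>u'\<close> into the left context of
  \<open>v\<close>.\<close>

lemma contexts_append:
  assumes "contexts L u = contexts L u'" and "contexts L v = contexts L v'"
  shows "contexts L (u @ v) = contexts L (u' @ v')"
proof -
  have "x @ u @ v @ y \<in> L \<longleftrightarrow> x @ u' @ v' @ y \<in> L" for x y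
  proof -
    have "x @ u @ v @ y \<in> L \<longleftrightarrow> x @ u' @ v @ y \<in> L"
      using assms(1) unfolding contexts_def set_eq_iff by auto
    also have "\<dots> \<longleftrightarrow> (x @ u') @ v @ y \<in> L" by simp
    also have "\<dots> \<longleftrightarrow> (x @ u') @ v' @ y \<in> L"
      using assms(2) unfolding contexts_def set_eq_iff by blast
    finally show ?thesis by simp
  qed
  then show ?thesis by (simp add: contexts_def)
qed

lemma mem_iff_contexts: "w \<in> L \<longleftrightarrow> ([], []) \<in> contexts L w"
  by (simp add: contexts_def)

lemma foldl_closed:
  assumes "\<forall>q\<in>Q. \<forall>a\<in>\<Sigma>. \<delta> q a \<in> Q" and "w \<in> lists \<Sigma>" and "q \<in> Q"
  shows "foldl \<delta> q w \<in> Q"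
  using assms(2,3)
proof (induction w arbitrary: q)
  case (Cons a w)
  then show ?case using assms(1) by simp
qed simp

text \<open>A word acts on the finite state set as a transformation, and this transformation
  determines its contexts.\<close>

lemma regular_lang_finite_contexts:
  assumes "regular_lang \<Sigma> L"
  shows "finite (contexts L ` lists \<Sigma>)"
proof -
  obtain Q :: "nat set" and q0 F \<delta> where fin: "finite Q" and q0: "q0 \<in> Q"
    and cl: "\<forall>q\<in>Q. \<forall>a\<in>\<Sigma>. \<delta> q a \<in> Q" and L: "L = {w \<in> lists \<Sigma>. foldl \<delta> q0 w \<in> F}"
    using assms unfolding regular_lang_def by metis
  \<comment> \<open>Restricting to \<open>Q\<close> makes these maps elements of the finite
    extensional function space on \<open>Q\<close>.\<close>
  let ?t = "\<lambda>u. restrict (\<lambda>q. foldl \<delta> q u) Q"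
  have "?t ` lists \<Sigma> \<subseteq> Q \<rightarrow>\<^sub>E Q"
  proof
    fix t assume "t \<in> ?t ` lists \<Sigma>"
    then obtain u where "u \<in> lists \<Sigma>" "t = ?t u" by blast
    then show "t \<in> Q \<rightarrow>\<^sub>E Q" using foldl_closed[OF cl] by simp
  qed
  then have "finite (?t ` lists \<Sigma>)"
    by (rule finite_subset) (simp add: fin finite_PiE)
  then show ?thesis
  proof (rule finite_image_factor)
    fix u v assume uv: "u \<in> lists \<Sigma>" "v \<in> lists \<Sigma>" "?t u = ?t v"
    have "x @ u @ y \<in> L \<longleftrightarrow> x @ v @ y \<in> L" for x y
    proof (cases "x \<in> lists \<Sigma>")
      case True
      then have "foldl \<delta> q0 x \<in> Q" using foldl_closed[OF cl _ q0] by blast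
      then have "foldl \<delta> (foldl \<delta> q0 x) u = foldl \<delta> (foldl \<delta> q0 x) v"
        using uv(3) by (metis restrict_apply')
      then show ?thesis using uv by (simp add: L)
    qed (simp add: L)
    then show "contexts L u = contexts L v" by (simp add: contexts_def)
  qed
qed

text \<open>Myhill-Nerode: the left quotients are the states of an automaton, numbered because
  states have to be naturals.\<close>

lemma regular_lang_if_finite_quotients:
  assumes "L \<subseteq> lists \<Sigma>" and "finite ((\<lambda>u. {y \<in> lists \<Sigma>. u @ y \<in> L}) ` lists \<Sigma>)"
  shows "regular_lang \<Sigma> L"
proof -
  define N where "N u = {y \<in> lists \<Sigma>. u @ y \<in> L}" for u
  have "finite (N ` lists \<Sigma>)" using assms(2) by (simp add: N_def)
  then obtain num :: "'a list set \<Rightarrow> nat" where num: "inj_on num (N ` lists \<Sigma>)"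
    using finite_imp_inj_to_nat_seg by blast
  define s where "s u = num (N u)" for u
  \<comment> \<open>A letter acts on a state through a chosen representative word. The next claim
    shows independence of this choice: words with equal quotients still have equal quotients after
    appending a letter.\<close>
  define \<delta> where "\<delta> q a = s ((SOME u. u \<in> lists \<Sigma> \<and> s u = q) @ [a])" for q a
  have \<delta>: "\<delta> (s u) a = s (u @ [a])" if "u \<in> lists \<Sigma>" "a \<in> \<Sigma>" for u a
  proof -
    define v where "v = (SOME v. v \<in> lists \<Sigma> \<and> s v = s u)"
    have v: "v \<in> lists \<Sigma> \<and> s v = s u"
      unfolding v_def by (rule someI[of _ u]) (use that in simp)
    then have "N v = N u"
      using num that unfolding s_def inj_on_def by blast
    then have "v @ a # y \<in> L \<longleftrightarrow> u @ a # y \<in> L" if "y \<in> lists \<Sigma>" for y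
      using that \<open>a \<in> \<Sigma>\<close> unfolding N_def set_eq_iff by (metis (mono_tags) Cons_in_lists_iff mem_Collect_eq)
    then have "N (v @ [a]) = N (u @ [a])"
      unfolding N_def by auto
    then show ?thesis unfolding \<delta>_def s_def[symmetric] v_def[symmetric] by (simp add: s_def)
  qed
  have run: "foldl \<delta> (s []) w = s w" if "w \<in> lists \<Sigma>" for w
    using that by (induction w rule: rev_induct) (auto simp: \<delta>)
  \<comment> \<open>Acceptance depends on the quotient alone, since \<open>w\<close> is in
    \<open>L\<close> iff the quotient contains \<open>[]\<close>.\<close>
  have acc: "s w \<in> s ` L \<longleftrightarrow> w \<in> L" if "w \<in> lists \<Sigma>" for w
  proof
    assume "s w \<in> s ` L"
    then obtain v where v: "v \<in> L" "s w = s v" by blast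
    then have "N w = N v"
      using num that assms(1) unfolding s_def inj_on_def by blast
    moreover have "[] \<in> N v" using v by (simp add: N_def)
    ultimately have "[] \<in> N w" by simp
    then show "w \<in> L" by (simp add: N_def)
  qed blast
  show ?thesis unfolding regular_lang_def
  proof (intro exI conjI)
    show "finite (s ` lists \<Sigma>)"
      using \<open>finite (N ` lists \<Sigma>)\<close> unfolding s_def by (metis finite_imageI image_image)
    show "s [] \<in> s ` lists \<Sigma>" by blast
    show "s ` L \<subseteq> s ` lists \<Sigma>" using assms(1) by blast
    show "\<forall>q\<in>s ` lists \<Sigma>. \<forall>a\<in>\<Sigma>. \<delta> q a \<in> s ` lists \<Sigma>"
      by (auto simp: \<delta>)
    show "L = {w \<in> lists \<Sigma>. foldl \<delta> (s []) w \<in> s ` L}"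
    proof (rule set_eqI)
      fix w
      show "w \<in> L \<longleftrightarrow> w \<in> {w \<in> lists \<Sigma>. foldl \<delta> (s []) w \<in> s ` L}"
        using assms(1) run[of w] acc[of w] by (cases "w \<in> lists \<Sigma>") auto
    qed
  qed
qed

section \<open>Circular words as conjugacy classes\<close>

lemma cword_eq_iff: "cword u = cword v \<longleftrightarrow> conjugate u v"
  by transfer simp

lemma cword_append_commute: "cword (u @ v) = cword (v @ u)"
  unfolding cword_eq_iff conjugate_def by blast

lemma cword_in_cwords_iff: "cword w \<in> cwords \<Sigma> \<longleftrightarrow> w \<in> lists \<Sigma>"
proof
  assume "cword w \<in> cwords \<Sigma>"
  then obtain v where "v \<in> lists \<Sigma>" "conjugate w v"
    unfolding cwords_def image_iff cword_eq_iff by blast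
  then show "w \<in> lists \<Sigma>" unfolding conjugate_def by force
qed (simp add: cwords_def)

text \<open>Rotation preserves the letters, so the preimage of \<open>LC\<close> already lies in
  \<open>lists \<Sigma>\<close>. The unrestricted preimage is the form used in
  \<open>word_class\<close>.\<close>

lemma regular_clang_iff:
  assumes "LC \<subseteq> cwords \<Sigma>"
  shows "regular_clang \<Sigma> LC \<longleftrightarrow> regular_lang \<Sigma> {w. cword w \<in> LC}"
proof -
  have "{w \<in> lists \<Sigma>. cword w \<in> LC} = {w. cword w \<in> LC}"
  proof (intro equalityI subsetI)
    fix w assume w: "w \<in> {w. cword w \<in> LC}"
    then have "cword w \<in> cwords \<Sigma>" using assms by blast
    then have "w \<in> lists \<Sigma>" unfolding cword_in_cwords_iff .
    with w show "w \<in> {w \<in> lists \<Sigma>. cword w \<in> LC}" by simp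
  qed simp
  then show ?thesis by (simp add: regular_clang_def)
qed


section \<open>Hom spaces and behaviours\<close>

definition behaviour ::
  "'a set \<Rightarrow> 'a list set \<Rightarrow> 'a cword set \<Rightarrow> sign list \<Rightarrow> sign list \<Rightarrow> 'a cob \<Rightarrow> 'a cob set" where
  "behaviour \<Sigma> LI LC \<epsilon> \<epsilon>' f = {h \<in> Hom_cob \<Sigma> \<epsilon>' \<epsilon>. evaluation LI LC (cl \<epsilon> \<epsilon>' f h)}"

text \<open>A class is determined by the union of the behaviours of any representative. Singletons
  show that there are at least as many classes as behaviours; conversely, \<open>n\<close>
  behaviours have at most \<open>2^n\<close> unions.\<close>

lemma finite_Hom_alpha_iff:
  "finite (Hom_alpha \<Sigma> LI LC \<epsilon> \<epsilon>') \<longleftrightarrow> finite (behaviour \<Sigma> LI LC \<epsilon> \<epsilon>' ` Hom_cob \<Sigma> \<epsilon> \<epsilon>')"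
proof -
  let ?b = "behaviour \<Sigma> LI LC \<epsilon> \<epsilon>'" and ?H = "Hom_cob \<Sigma> \<epsilon> \<epsilon>'"
  let ?r = "alpha_equiv \<Sigma> LI LC \<epsilon> \<epsilon>'"
  have r: "(F, G) \<in> ?r \<longleftrightarrow> F \<in> Fpow ?H \<and> G \<in> Fpow ?H \<and> \<Union> (?b ` F) = \<Union> (?b ` G)" for F G
  proof -
    have "(\<forall>h \<in> Hom_cob \<Sigma> \<epsilon>' \<epsilon>. (\<exists>f\<in>F. evaluation LI LC (cl \<epsilon> \<epsilon>' f h)) \<longleftrightarrow>
        (\<exists>g\<in>G. evaluation LI LC (cl \<epsilon> \<epsilon>' g h))) \<longleftrightarrow> \<Union> (?b ` F) = \<Union> (?b ` G)"
      unfolding behaviour_def set_eq_iff by auto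
    then show ?thesis unfolding alpha_equiv_def by simp
  qed
  have cls: "?r `` {F} = {G \<in> Fpow ?H. \<Union> (?b ` G) = \<Union> (?b ` F)}" if "F \<in> Fpow ?H" for F
    using that r by (intro set_eqI) (simp, metis)
  show ?thesis
  proof
    assume fin: "finite (Hom_alpha \<Sigma> LI LC \<epsilon> \<epsilon>')"
    have sing: "{f} \<in> Fpow ?H" if "f \<in> ?H" for f
      using that by (simp add: Fpow_def)
    have "(\<lambda>f. ?r `` {{f}}) ` ?H \<subseteq> Hom_alpha \<Sigma> LI LC \<epsilon> \<epsilon>'"
      unfolding Hom_alpha_def using sing by (auto intro: quotientI)
    then have "finite ((\<lambda>f. ?r `` {{f}}) ` ?H)" using fin by (rule finite_subset)
    then show "finite (?b ` ?H)"
    proof (rule finite_image_factor)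
      fix f g assume fg: "f \<in> ?H" "g \<in> ?H" "?r `` {{f}} = ?r `` {{g}}"
      have "{f} \<in> ?r `` {{f}}" using cls[OF sing[OF fg(1)]] sing[OF fg(1)] by simp
      with fg(3) have "{f} \<in> ?r `` {{g}}" by simp
      then show "?b f = ?b g" using cls[OF sing[OF fg(2)]] by simp
    qed
  next
    assume fin: "finite (?b ` ?H)"
    have "Hom_alpha \<Sigma> LI LC \<epsilon> \<epsilon>'
        \<subseteq> (\<lambda>\<B>. {G \<in> Fpow ?H. \<Union> (?b ` G) = \<Union> \<B>}) ` Pow (?b ` ?H)"
    proof
      fix X assume "X \<in> Hom_alpha \<Sigma> LI LC \<epsilon> \<epsilon>'"
      then obtain F where F: "F \<in> Fpow ?H" "X = ?r `` {F}"
        unfolding Hom_alpha_def by (auto elim: quotientE)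
      then have "X = {G \<in> Fpow ?H. \<Union> (?b ` G) = \<Union> (?b ` F)}" using cls by simp
      moreover from F have "?b ` F \<in> Pow (?b ` ?H)" by (auto simp: Fpow_def)
      ultimately show "X \<in> (\<lambda>\<B>. {G \<in> Fpow ?H. \<Union> (?b ` G) = \<Union> \<B>}) ` Pow (?b ` ?H)"
        by (rule image_eqI)
    qed
    then show "finite (Hom_alpha \<Sigma> LI LC \<epsilon> \<epsilon>')"
      by (rule finite_subset) (use fin in simp)
  qed
qed


section \<open>Joining\<close>

text \<open>Ensures that both definite descriptions in \<open>join\<close> denote.\<close>

definition joinable :: "endpoint \<Rightarrow> 'a cob \<Rightarrow> bool" where
  "joinable p M \<longleftrightarrow> size {#c \<in># M. leaves c p#} = 1 \<and> size {#c \<in># M. enters c p#} = 1"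

lemma enters_iff: "enters c p \<longleftrightarrow> (\<exists>q w. c = Arc q w p)"
  by (cases c) auto

lemma leaves_iff: "leaves c p \<longleftrightarrow> (\<exists>w q. c = Arc p w q)"
  by (cases c) auto

lemma join_same:
  assumes "joinable p (add_mset (Arc p w p) M)"
  shows "join p (add_mset (Arc p w p) M) = add_mset (Circle (cword w)) M"
proof -
  let ?N = "add_mset (Arc p w p) M"
  have no: "\<not> leaves c p" "\<not> enters c p" if "c \<in># M" for c
    using assms that by (simp_all add: joinable_def)
  have "(THE c. c \<in># ?N \<and> enters c p) = Arc p w p"
    using no by (intro the_equality) auto
  moreover have "(THE c. c \<in># ?N \<and> leaves c p) = Arc p w p"
    using no by (intro the_equality) auto
  ultimately show ?thesis by (simp add: join_def)
qed

lemma join_distinct: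
  assumes "joinable p (add_mset (Arc q u p) (add_mset (Arc p v r) M))"
  shows "join p (add_mset (Arc q u p) (add_mset (Arc p v r) M)) = add_mset (Arc q (u @ v) r) M"
proof -
  let ?N = "add_mset (Arc q u p) (add_mset (Arc p v r) M)"
  \<comment> \<open>If \<open>q\<close> were \<open>p\<close>, two arcs would leave
    \<open>p\<close>; if \<open>r\<close> were \<open>p\<close>, two would enter it.\<close>
  have ne: "q \<noteq> p" "r \<noteq> p"
    using assms by (auto simp: joinable_def)
  then have no: "\<not> leaves c p" "\<not> enters c p" if "c \<in># M" for c
    using assms that ne by (simp_all add: joinable_def)
  have "(THE c. c \<in># ?N \<and> enters c p) = Arc q u p"
    using no ne by (intro the_equality) auto
  moreover have "(THE c. c \<in># ?N \<and> leaves c p) = Arc p v r"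
    using no ne by (intro the_equality) auto
  ultimately show ?thesis using ne by (simp add: join_def)
qed

text \<open>Reduces reasoning about \<open>join\<close> to explicit multisets: the strand entering
  \<open>p\<close> either is the one leaving it or is a different arc.\<close>

lemma joinable_cases:
  assumes "joinable p M"
  obtains (same) w M' where "M = add_mset (Arc p w p) M'"
  | (distinct) q u v r M' where "M = add_mset (Arc q u p) (add_mset (Arc p v r) M')"
proof -
  obtain c where "{#c \<in># M. enters c p#} = {#c#}"
    using assms size_1_singleton_mset unfolding joinable_def by blast
  then have "c \<in># {#c \<in># M. enters c p#}" by simp
  then have c: "c \<in># M" "enters c p" by auto
  obtain d where "{#c \<in># M. leaves c p#} = {#d#}"
    using assms size_1_singleton_mset unfolding joinable_def by blast
  then have "d \<in># {#c \<in># M. leaves c p#}" by simp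
  then have d: "d \<in># M" "leaves d p" by auto
  obtain q u where cq: "c = Arc q u p" using c enters_iff by blast
  obtain v r where dr: "d = Arc p v r" using d leaves_iff by blast
  show thesis
  proof (cases "c = d")
    case True
    then show thesis using same c cq dr by (metis component.inject(1) insert_DiffM)
  next
    case False
    obtain M1 where M1: "M = add_mset c M1" using c(1) by (metis insert_DiffM)
    with d(1) False have "d \<in># M1" by simp
    then obtain M2 where "M1 = add_mset d M2" by (metis insert_DiffM)
    with M1 have "M = add_mset c (add_mset d M2)" by simp
    then show thesis using distinct cq dr by blast
  qed
qed

text \<open>Joining at \<open>p\<close> consumes ends at \<open>p\<close> only; the far ends pass
  unchanged to the merged arc, so the counts at \<open>q\<close> stay the same.\<close>

lemma joinable_join:
  assumes "joinable p M" and "joinable q M" and "p \<noteq> q"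
  shows "joinable q (join p M)"
  using assms(1)
proof (cases rule: joinable_cases)
  case (same w M')
  then have "join p M = add_mset (Circle (cword w)) M'"
    using assms(1) join_same by blast
  then show ?thesis using assms(2,3) unfolding same by (simp add: joinable_def)
next
  case (distinct r u v s M')
  then have "join p M = add_mset (Arc r (u @ v) s) M'"
    using assms(1) join_distinct by blast
  then show ?thesis using assms(2,3) unfolding distinct
    by (simp add: joinable_def split: if_splits)
qed


section \<open>States of cobordisms\<close>

text \<open>The components excluded here are the closed ones, floating intervals and circles, which
  no join at an outer endpoint touches.\<close>

fun outer :: "'a component \<Rightarrow> bool" where
  "outer (Arc p w q) \<longleftrightarrow> p \<noteq> Inner \<or> q \<noteq> Inner"
| "outer (Circle c) \<longleftrightarrow> False"

type_synonym 'a word_class = "('a list \<times> 'a list) set \<times> ('a list \<times> 'a list) set"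

text \<open>An arc may end up inside an interval or inside a circle, hence syntactic classes for
  both languages are recorded.\<close>

definition word_class :: "'a list set \<Rightarrow> 'a cword set \<Rightarrow> 'a list \<Rightarrow> 'a word_class" where
  "word_class LI LC w = (contexts LI w, contexts {w. cword w \<in> LC} w)"

text \<open>Only applied to outer components, which are arcs; the selectors are unspecified on
  circles.\<close>

definition arc_class ::
  "'a list set \<Rightarrow> 'a cword set \<Rightarrow> 'a component \<Rightarrow> endpoint \<times> 'a word_class \<times> endpoint" where
  "arc_class LI LC c = (src c, word_class LI LC (labels c), tgt c)"

definition state ::
  "'a list set \<Rightarrow> 'a cword set \<Rightarrow> 'a cob \<Rightarrow> (endpoint \<times> 'a word_class \<times> endpoint) multiset \<times> bool"
where
  "state LI LC M =
     (image_mset (arc_class LI LC) (filter_mset outer M),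
      evaluation LI LC (filter_mset (\<lambda>c. \<not> outer c) M))"

lemma word_class_append:
  assumes "word_class LI LC u = word_class LI LC u'" and "word_class LI LC v = word_class LI LC v'"
  shows "word_class LI LC (u @ v) = word_class LI LC (u' @ v')"
  using assms by (simp add: word_class_def contexts_append[of _ u u' v v'])

lemma word_class_eqD:
  assumes "word_class LI LC u = word_class LI LC v"
  shows "u \<in> LI \<longleftrightarrow> v \<in> LI" and "cword u \<in> LC \<longleftrightarrow> cword v \<in> LC"
proof -
  show "u \<in> LI \<longleftrightarrow> v \<in> LI"
    using assms mem_iff_contexts[of u LI] mem_iff_contexts[of v LI] unfolding word_class_def by blast
  show "cword u \<in> LC \<longleftrightarrow> cword v \<in> LC"
    using assms mem_iff_contexts[of u "{w. cword w \<in> LC}"] mem_iff_contexts[of v "{w. cword w \<in> LC}"]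
    unfolding word_class_def by blast
qed

lemma evaluation_simps [simp]:
  "evaluation LI LC {#}"
  "evaluation LI LC (add_mset c M) \<longleftrightarrow> eval_component LI LC c \<and> evaluation LI LC M"
  "evaluation LI LC (M + N) \<longleftrightarrow> evaluation LI LC M \<and> evaluation LI LC N"
  by (auto simp: evaluation_def)

lemma state_union_cong:
  "state LI LC M = state LI LC N \<Longrightarrow> state LI LC (M + K) = state LI LC (N + K)"
  by (simp add: state_def)

text \<open>With both ends \<open>Inner\<close> the arc contributes to the Boolean part instead of
  the multiset; there equal word classes give equal membership in \<open>LI\<close>. Such arcs do
  arise from joins.\<close>

lemma state_add_Arc_cong:
  assumes "state LI LC M = state LI LC N" and "word_class LI LC u = word_class LI LC v"
  shows "state LI LC (add_mset (Arc p u q) M) = state LI LC (add_mset (Arc p v q) N)"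
  using assms word_class_eqD(1)[OF assms(2)] by (auto simp: state_def arc_class_def)

lemma state_add_Circle_cong:
  assumes "state LI LC M = state LI LC N" and "word_class LI LC u = word_class LI LC v"
  shows "state LI LC (add_mset (Circle (cword u)) M) = state LI LC (add_mset (Circle (cword v)) N)"
  using assms word_class_eqD(2)[OF assms(2)] by (auto simp: state_def)

text \<open>Outer arcs are recorded individually, so an equal state must contain a matching arc, and
  cancelling the two leaves equal states.\<close>

lemma state_add_ArcE:
  assumes "state LI LC (add_mset (Arc p u q) M) = state LI LC N" and "p \<noteq> Inner \<or> q \<noteq> Inner"
  obtains v N' where "N = add_mset (Arc p v q) N'"
    and "word_class LI LC u = word_class LI LC v" and "state LI LC M = state LI LC N'"
proof -
  have "image_mset (arc_class LI LC) (filter_mset outer N)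
      = add_mset (p, word_class LI LC u, q) (image_mset (arc_class LI LC) (filter_mset outer M))"
    using assms by (simp add: state_def arc_class_def)
  then obtain c N1 where "filter_mset outer N = add_mset c N1"
    and c: "arc_class LI LC c = (p, word_class LI LC u, q)"
    by (metis msed_map_invR)
  then have "c \<in># filter_mset outer N" by simp
  then have cN: "c \<in># N" "outer c" by auto
  then obtain v where v: "c = Arc p v q" "word_class LI LC u = word_class LI LC v"
    using c by (cases c) (auto simp: arc_class_def)
  from cN v have N: "N = add_mset (Arc p v q) (N - {#c#})" by simp
  have "state LI LC M = state LI LC (N - {#c#})"
    using assms v(2) by (subst (asm) N) (auto simp: state_def arc_class_def)
  then show thesis using that N v by blast
qed

text \<open>Arcs meeting \<open>p\<close> are outer, so those of \<open>M\<close> have partners in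
  \<open>N\<close> with the same ends. Both sides then undergo the same kind of join, on equivalent
  words.\<close>

lemma state_join_cong:
  assumes "state LI LC M = state LI LC N" and "joinable p M" and "joinable p N" and "p \<noteq> Inner"
  shows "state LI LC (join p M) = state LI LC (join p N)"
  using assms(2)
proof (cases rule: joinable_cases)
  case (same w M')
  have "state LI LC (add_mset (Arc p w p) M') = state LI LC N"
    using assms(1) same by simp
  then obtain w' N' where N: "N = add_mset (Arc p w' p) N'"
    "word_class LI LC w = word_class LI LC w'" "state LI LC M' = state LI LC N'"
    by (rule state_add_ArcE) (use assms(4) in simp)
  have "join p M = add_mset (Circle (cword w)) M'" "join p N = add_mset (Circle (cword w')) N'"
    using same N(1) assms(2,3) join_same by blast+
  then show ?thesis using state_add_Circle_cong[OF N(3,2)] by simp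
next
  case (distinct q u v r M')
  have "state LI LC (add_mset (Arc q u p) (add_mset (Arc p v r) M')) = state LI LC N"
    using assms(1) distinct by simp
  then obtain u' N1 where 1: "N = add_mset (Arc q u' p) N1"
    "word_class LI LC u = word_class LI LC u'"
    "state LI LC (add_mset (Arc p v r) M') = state LI LC N1"
    by (rule state_add_ArcE) (use assms(4) in simp)
  from 1(3) obtain v' N' where 2: "N1 = add_mset (Arc p v' r) N'"
    "word_class LI LC v = word_class LI LC v'" "state LI LC M' = state LI LC N'"
    by (rule state_add_ArcE) (use assms(4) in simp)
  have "join p M = add_mset (Arc q (u @ v) r) M'" "join p N = add_mset (Arc q (u' @ v') r) N'"
    using distinct 1(1) 2(1) assms(2,3) join_distinct by blast+
  then show ?thesis
    using state_add_Arc_cong[OF 2(3) word_class_append[OF 1(2) 2(2)]] by simp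
qed

lemma state_fold_join_cong:
  assumes "state LI LC M = state LI LC N" and "distinct ps" and "Inner \<notin> set ps"
    and "\<And>p. p \<in> set ps \<Longrightarrow> joinable p M" and "\<And>p. p \<in> set ps \<Longrightarrow> joinable p N"
  shows "state LI LC (fold join ps M) = state LI LC (fold join ps N)"
  using assms
proof (induction ps arbitrary: M N)
  case (Cons p ps)
  have "state LI LC (fold join ps (join p M)) = state LI LC (fold join ps (join p N))"
  proof (rule Cons.IH)
    show "state LI LC (join p M) = state LI LC (join p N)"
      using Cons.prems by (intro state_join_cong) auto
    show "joinable q (join p M)" "joinable q (join p N)" if "q \<in> set ps" for q
      using that Cons.prems by (auto intro!: joinable_join)
  qed (use Cons.prems in auto)
  then show ?case by simp
qed simp

text \<open>The evaluation can be read off the state: closed components through the Boolean, outer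
  arcs by testing the empty context for \<open>LI\<close>. This covers all multisets of components,
  hence also the result of \<open>cl\<close>.\<close>

lemma evaluation_state_cong:
  assumes "state LI LC M = state LI LC N"
  shows "evaluation LI LC M \<longleftrightarrow> evaluation LI LC N"
proof -
  have "evaluation LI LC M \<longleftrightarrow> snd (state LI LC M) \<and>
      (\<forall>x \<in># fst (state LI LC M). ([], []) \<in> fst (fst (snd x)))" for M
  proof -
    have "evaluation LI LC (filter_mset outer M) \<longleftrightarrow>
        (\<forall>x \<in># fst (state LI LC M). ([], []) \<in> fst (fst (snd x)))"
    proof -
      have "eval_component LI LC c \<longleftrightarrow> ([], []) \<in> fst (fst (snd (arc_class LI LC c)))"
        if "outer c" for c
        using that by (cases c) (auto simp: arc_class_def word_class_def contexts_def)
      then show ?thesis by (auto simp: evaluation_def state_def)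
    qed
    moreover have "evaluation LI LC M \<longleftrightarrow> snd (state LI LC M) \<and> evaluation LI LC (filter_mset outer M)"
      by (auto simp: state_def evaluation_def)
    ultimately show ?thesis by simp
  qed
  then show ?thesis using assms by simp
qed

section \<open>Renaming endpoints and gluing\<close>

lemma swap_endpoint_eq_iff: "swap_endpoint p = q \<longleftrightarrow> p = swap_endpoint q"
  by (cases p; cases q) auto

lemma leaves_swap: "leaves (swap_component c) p \<longleftrightarrow> leaves c (swap_endpoint p)"
  by (cases c) (auto simp: swap_endpoint_eq_iff)

lemma enters_swap: "enters (swap_component c) p \<longleftrightarrow> enters c (swap_endpoint p)"
  by (cases c) (auto simp: swap_endpoint_eq_iff)

lemma size_filter_image_mset:
  "size (filter_mset P (image_mset f M)) = size (filter_mset (\<lambda>x. P (f x)) M)"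
  by (simp add: filter_mset_image_mset)

text \<open>The renaming exchanges bottom and top but keeps orientations, so each glued point is a
  source for one of \<open>f\<close>, \<open>h\<close> and a sink for the other.\<close>

lemma joinable_glued:
  assumes "f \<in> Hom_cob \<Sigma> \<epsilon> \<epsilon>'" and "h \<in> Hom_cob \<Sigma> \<epsilon>' \<epsilon>"
    and "p \<in> set (map Bot [0..<length \<epsilon>] @ map Top [0..<length \<epsilon>'])"
  shows "joinable p (f + image_mset swap_component h)"
proof -
  have p: "p \<noteq> Inner" "swap_endpoint p \<noteq> Inner" using assms(3) by auto
  have "swap_endpoint p \<in> sources \<epsilon>' \<epsilon> \<longleftrightarrow> p \<in> sinks \<epsilon> \<epsilon>'"
    "swap_endpoint p \<in> sinks \<epsilon>' \<epsilon> \<longleftrightarrow> p \<in> sources \<epsilon> \<epsilon>'"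
    by (cases p; auto simp: sources_def sinks_def)+
  moreover have "p \<in> sources \<epsilon> \<epsilon>' \<longleftrightarrow> p \<notin> sinks \<epsilon> \<epsilon>'"
    using assms(3) by (auto simp: sources_def sinks_def intro: sign.exhaust)
  ultimately show ?thesis
    using assms(1,2) p
    by (auto simp: joinable_def Hom_cob_def size_filter_image_mset leaves_swap enters_swap)
qed

lemma behaviour_state_cong:
  assumes "f \<in> Hom_cob \<Sigma> \<epsilon> \<epsilon>'" and "g \<in> Hom_cob \<Sigma> \<epsilon> \<epsilon>'" and "state LI LC f = state LI LC g"
  shows "behaviour \<Sigma> LI LC \<epsilon> \<epsilon>' f = behaviour \<Sigma> LI LC \<epsilon> \<epsilon>' g"
proof -
  have "evaluation LI LC (cl \<epsilon> \<epsilon>' f h) \<longleftrightarrow> evaluation LI LC (cl \<epsilon> \<epsilon>' g h)"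
    if "h \<in> Hom_cob \<Sigma> \<epsilon>' \<epsilon>" for h
    unfolding cl_def
  proof (intro evaluation_state_cong state_fold_join_cong state_union_cong assms(3))
    show "distinct (map Bot [0..<length \<epsilon>] @ map Top [0..<length \<epsilon>'])"
      by (auto simp: distinct_map inj_on_def)
    show "joinable p (f + image_mset swap_component h)"
      if "p \<in> set (map Bot [0..<length \<epsilon>] @ map Top [0..<length \<epsilon>'])" for p
      using joinable_glued[OF assms(1) \<open>h \<in> Hom_cob \<Sigma> \<epsilon>' \<epsilon>\<close> that] .
    show "joinable p (g + image_mset swap_component h)"
      if "p \<in> set (map Bot [0..<length \<epsilon>] @ map Top [0..<length \<epsilon>'])" for p
      using joinable_glued[OF assms(2) \<open>h \<in> Hom_cob \<Sigma> \<epsilon>' \<epsilon>\<close> that] .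
  qed auto
  then show ?thesis by (auto simp: behaviour_def)
qed

section \<open>Finiteness of the set of states\<close>

lemma Hom_cob_endpoints:
  assumes "f \<in> Hom_cob \<Sigma> \<epsilon> \<epsilon>'" and "Arc p w q \<in># f"
  shows "p \<in> insert Inner (sources \<epsilon> \<epsilon>')" and "q \<in> insert Inner (sinks \<epsilon> \<epsilon>')"
proof -
  have "Arc p w q \<in># {#c \<in># f. leaves c p#}" "Arc p w q \<in># {#c \<in># f. enters c q#}"
    using assms(2) by auto
  then have "size {#c \<in># f. leaves c p#} \<noteq> 0" "size {#c \<in># f. enters c q#} \<noteq> 0"
    by auto
  then show "p \<in> insert Inner (sources \<epsilon> \<epsilon>')" "q \<in> insert Inner (sinks \<epsilon> \<epsilon>')"
    using assms(1) unfolding Hom_cob_def by (auto split: if_splits)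
qed

text \<open>Outer endpoints are used once, so the multiset of arc classes is in fact a set; this makes
  the number of states finite.\<close>

lemma count_state_le_1:
  assumes "f \<in> Hom_cob \<Sigma> \<epsilon> \<epsilon>'"
  shows "count (fst (state LI LC f)) x \<le> 1"
proof (cases x)
  case (fields p k q)
  let ?n = "size {#c \<in># f. outer c \<and> arc_class LI LC c = x#}"
  have n: "count (fst (state LI LC f)) x = ?n"
    by (simp add: state_def count_image_mset' count_conv_size_mset filter_filter_mset
        filter_mset_image_mset conj_commute eq_commute)
  have one: "size {#c \<in># f. leaves c p#} \<le> 1" if "p \<noteq> Inner" for p
    using assms that by (simp add: Hom_cob_def)
  have one': "size {#c \<in># f. enters c p#} \<le> 1" if "p \<noteq> Inner" for p
    using assms that by (simp add: Hom_cob_def)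
  show ?thesis
  proof (cases "p = Inner \<and> q = Inner")
    case True
    then have "\<not> (outer c \<and> arc_class LI LC c = x)" for c
      using fields by (cases c) (auto simp: arc_class_def)
    then have "{#c \<in># f. outer c \<and> arc_class LI LC c = x#} = {#}" by auto
    then show ?thesis unfolding n by (simp only: size_empty)
  next
    case False
    \<comment> \<open>A component of class \<open>x\<close> leaves \<open>p\<close> and enters
      \<open>q\<close>; whichever of these is an outer endpoint bounds the count by one.\<close>
    have arc: "c = Arc p (labels c) q" if "outer c \<and> arc_class LI LC c = x" for c
      using that fields by (cases c) (auto simp: arc_class_def)
    have mono: "?n \<le> size {#c \<in># f. P c#}" if "\<And>c. outer c \<and> arc_class LI LC c = x \<Longrightarrow> P c" for P
    proof -
      have eq: "{#c \<in># f. outer c \<and> arc_class LI LC c = x#}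
          = {#c \<in># {#c \<in># f. P c#}. outer c \<and> arc_class LI LC c = x#}"
        unfolding filter_filter_mset using that by (intro filter_mset_cong) auto
      show ?thesis by (subst eq) (intro size_mset_mono multiset_filter_subset)
    qed
    have "?n \<le> size {#c \<in># f. leaves c p#}" "?n \<le> size {#c \<in># f. enters c q#}"
      using arc by (intro mono; (subst leaves_iff enters_iff)?; blast)+
    then show ?thesis using False one[of p] one'[of q] n by linarith
  qed
qed

lemma finite_sources_sinks: "finite (sources \<epsilon> \<epsilon>')" "finite (sinks \<epsilon> \<epsilon>')"
  by (simp_all add: sources_def sinks_def)

text \<open>Without repetitions, the multiset of a state is \<open>mset_set\<close> of a subset of
  the finite set \<open>?A\<close> of possible arc classes.\<close>

lemma finite_states:
  assumes "finite (word_class LI LC ` lists \<Sigma>)"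
  shows "finite (state LI LC ` Hom_cob \<Sigma> \<epsilon> \<epsilon>')"
proof -
  let ?A = "insert Inner (sources \<epsilon> \<epsilon>') \<times> word_class LI LC ` lists \<Sigma> \<times> insert Inner (sinks \<epsilon> \<epsilon>')"
  have "state LI LC ` Hom_cob \<Sigma> \<epsilon> \<epsilon>' \<subseteq> (mset_set ` Pow ?A) \<times> UNIV"
  proof
    fix s assume "s \<in> state LI LC ` Hom_cob \<Sigma> \<epsilon> \<epsilon>'"
    then obtain f where f: "f \<in> Hom_cob \<Sigma> \<epsilon> \<epsilon>'" and s: "s = state LI LC f" by blast
    have "set_mset (fst s) \<subseteq> ?A"
    proof
      fix x assume "x \<in># fst s"
      then obtain c where c: "c \<in># f" "outer c" "x = arc_class LI LC c"
        by (auto simp: s state_def)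
      then obtain p w q where pwq: "c = Arc p w q" by (cases c) auto
      moreover have "w \<in> lists \<Sigma>" using f c pwq by (force simp: Hom_cob_def)
      ultimately show "x \<in> ?A"
        using Hom_cob_endpoints[OF f, of p w q] c by (auto simp: arc_class_def)
    qed
    moreover have "fst s = mset_set (set_mset (fst s))"
    proof (rule multiset_eqI)
      fix x
      show "count (fst s) x = count (mset_set (set_mset (fst s))) x"
      proof (cases "x \<in># fst s")
        case True
        then have "count (fst s) x = 1"
          using count_state_le_1[OF f, of LI LC x] s by (simp add: count_greater_eq_one_iff antisym)
        with True show ?thesis by simp
      qed (simp add: not_in_iff)
    qed
    ultimately show "s \<in> (mset_set ` Pow ?A) \<times> UNIV"
      by (metis PowI UNIV_I imageI mem_Times_iff)
  qed
  then show ?thesis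
    by (rule finite_subset) (use assms finite_sources_sinks in simp)
qed


section \<open>Regularity of the category and of the languages\<close>

text \<open>Finiteness is passed along from contexts to word classes, states, behaviours and finally
  hom spaces.\<close>

lemma C_regular_if_regular:
  assumes "regular_lang \<Sigma> LI" and "regular_clang \<Sigma> LC" and "LC \<subseteq> cwords \<Sigma>"
  shows "C_regular \<Sigma> LI LC"
proof -
  let ?P = "{w. cword w \<in> LC}"
  have "finite (contexts LI ` lists \<Sigma> \<times> contexts ?P ` lists \<Sigma>)"
    using assms by (simp add: regular_lang_finite_contexts regular_clang_iff)
  then have "finite (word_class LI LC ` lists \<Sigma>)"
    by (rule rev_finite_subset) (auto simp: word_class_def)
  then have "finite (behaviour \<Sigma> LI LC \<epsilon> \<epsilon>' ` Hom_cob \<Sigma> \<epsilon> \<epsilon>')" for \<epsilon> \<epsilon>'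
    by (rule finite_image_factor[OF finite_states]) (rule behaviour_state_cong)
  then show ?thesis by (simp add: C_regular_def finite_Hom_alpha_iff)
qed

text \<open>Common core of the two converse directions: if \<open>f u\<close> and \<open>f v\<close>
  have equal behaviours, testing them against all \<open>h y\<close> shows that \<open>u\<close> and
  \<open>v\<close> have equal left quotients.\<close>

lemma regular_lang_if_probes:
  assumes fin: "finite (Hom_alpha \<Sigma> LI LC \<epsilon> \<epsilon>')" and "L \<subseteq> lists \<Sigma>"
    and f: "\<And>u. u \<in> lists \<Sigma> \<Longrightarrow> f u \<in> Hom_cob \<Sigma> \<epsilon> \<epsilon>'"
    and h: "\<And>y. y \<in> lists \<Sigma> \<Longrightarrow> h y \<in> Hom_cob \<Sigma> \<epsilon>' \<epsilon>"
    and eval: "\<And>u y. evaluation LI LC (cl \<epsilon> \<epsilon>' (f u) (h y)) \<longleftrightarrow> u @ y \<in> L"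
  shows "regular_lang \<Sigma> L"
proof (rule regular_lang_if_finite_quotients)
  let ?b = "behaviour \<Sigma> LI LC \<epsilon> \<epsilon>'"
  have "(\<lambda>u. ?b (f u)) ` lists \<Sigma> \<subseteq> ?b ` Hom_cob \<Sigma> \<epsilon> \<epsilon>'"
    using f by blast
  then have "finite ((\<lambda>u. ?b (f u)) ` lists \<Sigma>)"
    by (rule finite_subset) (use fin finite_Hom_alpha_iff in blast)
  then show "finite ((\<lambda>u. {y \<in> lists \<Sigma>. u @ y \<in> L}) ` lists \<Sigma>)"
  proof (rule finite_image_factor)
    fix u v assume "?b (f u) = ?b (f v)"
    then have "h y \<in> ?b (f u) \<longleftrightarrow> h y \<in> ?b (f v)" for y by simp
    then show "{y \<in> lists \<Sigma>. u @ y \<in> L} = {y \<in> lists \<Sigma>. v @ y \<in> L}"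
      using h by (auto simp: behaviour_def eval)
  qed
qed (fact assms(2))

lemma regular_lang_if_C_regular:
  assumes "C_regular \<Sigma> LI LC" and "LI \<subseteq> lists \<Sigma>"
  shows "regular_lang \<Sigma> LI"
proof (rule regular_lang_if_probes)
  let ?f = "\<lambda>u. {#Arc Inner u (Top 0)#}" and ?h = "\<lambda>y. {#Arc (Bot 0) y Inner#}"
  show "finite (Hom_alpha \<Sigma> LI LC [] [Plus])" using assms by (simp add: C_regular_def)
  show "?f u \<in> Hom_cob \<Sigma> [] [Plus]" if "u \<in> lists \<Sigma>" for u
    using that by (auto simp: Hom_cob_def sources_def sinks_def)
  show "?h y \<in> Hom_cob \<Sigma> [Plus] []" if "y \<in> lists \<Sigma>" for y
    using that by (auto simp: Hom_cob_def sources_def sinks_def)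
  show "evaluation LI LC (cl [] [Plus] (?f u) (?h y)) \<longleftrightarrow> u @ y \<in> LI" for u y
  proof -
    \<comment> \<open>The end \<open>Bot 0\<close> of \<open>?h y\<close> has been renamed to
      \<open>Top 0\<close>, the only point to be glued.\<close>
    have "cl [] [Plus] (?f u) (?h y) =
        join (Top 0) (add_mset (Arc Inner u (Top 0)) (add_mset (Arc (Top 0) y Inner) {#}))"
      by (simp add: cl_def add_mset_commute)
    also have "\<dots> = {#Arc Inner (u @ y) Inner#}"
      by (rule join_distinct) (simp add: joinable_def)
    finally show ?thesis by simp
  qed
qed (fact assms(2))

lemma regular_clang_if_C_regular:
  assumes "C_regular \<Sigma> LI LC" and "LC \<subseteq> cwords \<Sigma>"
  shows "regular_clang \<Sigma> LC"
  unfolding regular_clang_iff[OF assms(2)]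
proof (rule regular_lang_if_probes)
  let ?f = "\<lambda>u. {#Arc (Bot 0) u (Top 0)#}"
  show "finite (Hom_alpha \<Sigma> LI LC [Plus] [Plus])" using assms by (simp add: C_regular_def)
  show "{w. cword w \<in> LC} \<subseteq> lists \<Sigma>"
  proof
    fix w assume "w \<in> {w. cword w \<in> LC}"
    then have "cword w \<in> cwords \<Sigma>" using assms(2) by blast
    then show "w \<in> lists \<Sigma>" unfolding cword_in_cwords_iff .
  qed
  show hom: "?f u \<in> Hom_cob \<Sigma> [Plus] [Plus]" if "u \<in> lists \<Sigma>" for u
    using that by (auto simp: Hom_cob_def sources_def sinks_def)
  show "?f u \<in> Hom_cob \<Sigma> [Plus] [Plus]" if "u \<in> lists \<Sigma>" for u using hom that .
  show "evaluation LI LC (cl [Plus] [Plus] (?f u) (?f y)) \<longleftrightarrow> u @ y \<in> {w. cword w \<in> LC}" for u y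
  proof -
    \<comment> \<open>After renaming, the second arc runs back from \<open>Top 0\<close> to
      \<open>Bot 0\<close>. The join at \<open>Bot 0\<close> comes first, so the circle is read as
      \<open>y @ u\<close>, which is conjugate to \<open>u @ y\<close>.\<close>
    have "cl [Plus] [Plus] (?f u) (?f y) = join (Top 0) (join (Bot 0)
        (add_mset (Arc (Top 0) y (Bot 0)) (add_mset (Arc (Bot 0) u (Top 0)) {#})))"
      by (simp add: cl_def add_mset_commute)
    also have "\<dots> = join (Top 0) {#Arc (Top 0) (y @ u) (Top 0)#}"
      by (subst join_distinct) (simp_all add: joinable_def)
    also have "\<dots> = {#Circle (cword (y @ u))#}"
      by (rule join_same) (simp add: joinable_def)
    finally show ?thesis by (simp add: cword_append_commute)
  qed
qed

theorem proposition3p19: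
  fixes \<Sigma> :: "'a set" and LI :: "'a list set" and LC :: "'a cword set"
  assumes "finite \<Sigma>" and "LI \<subseteq> lists \<Sigma>" and "LC \<subseteq> cwords \<Sigma>"
  shows "C_regular \<Sigma> LI LC \<longleftrightarrow> regular_lang \<Sigma> LI \<and> regular_clang \<Sigma> LC"
  using C_regular_if_regular regular_lang_if_C_regular regular_clang_if_C_regular assms(2,3)
  by metis

end
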